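(* Let $N\geq 1$ and $1\leq k\leq N$ be integers and let $\mathcal{E}=(E_i,\theta_i:1\leq i\leq N)$ be an $N$-player non-cooperative game with $E=E_1\times\cdots\times E_N$. Let $\Psi_k\colon E\times E\to\mathbb{R}$ be the $k$-lateral Nikaido--Isoda function of $\mathcal{E}$ and define its marginal function by $$V_k\colon E\longrightarrow\mathbb{R}\cup\{\infty\},\qquad x\longmapsto\sup\{\Psi_k(x,y):y\in E\}.$$ Then a global strategy $x\in E$ is a $k$-lateral Nash equilibrium of $\mathcal{E}$ if and only if $V_k(x)=0$.
   Context: Write $[N]=\{1,\dots,N\}$ and $\binom{[N]}{k}$ for the set of $k$-element subsets of $[N]$. An $N$-player non-cooperative game $\mathcal{E}=(E_i,\theta_i:1\leq i\leq N)$ consists of (metric) spaces $E_1,\dots,E_N$ and (continuous) functions $\theta_i\colon E=E_1\times\cdots\times E_N\to\mathbb{R}$. Elements of $E$ are called global strategies. For $I\in\binom{[N]}{k}$ put $E_I=\prod_{i\in I}E_i$; for $y\in E$, $y_I\in E_I$ is its projection; for $x\in E$ and $y_I\in E_I$, $(y_I,x_{-I})\in E$ is obtained from $x$ by replacing the coordinates indexed by $I$ with those of $y_I$. A global strategy $x$ is a $k$-lateral Nash equilibrium if $\theta_i(x)\geq\theta_i(y_I,x_{-I})$ for every $I\in\binom{[N]}{k}$, every $i\in I$ and every $y_I\in E_I$. The $k$-lateral Nikaido--Isoda function is $$\Psi_k(x,y)=\max_{I\in\binom{[N]}{k}}\max_{i\in I}\big(\theta_i(y_I,x_{-I})-\theta_i(x_I,x_{-I})\big).$$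 *)

theory Defs
  imports "HOL-Analysis.Analysis"
begin

text \<open>
  The players are \<open>1, \<dots>, N\<close>. The strategy spaces \<open>E 1, \<dots>, E N\<close> are arbitrary abstract metric
  spaces over a common ambient type \<open>'a\<close>, each with its own carrier and its own distance; spaces
  over different types are covered by taking \<open>'a\<close> to be their sum type.
  The values of \<open>E\<close> and \<open>\<theta>\<close> at indices outside \<open>{1..N}\<close> play no role.
\<close>

definition partial_strategies :: "(nat \<Rightarrow> 'a metric) \<Rightarrow> nat set \<Rightarrow> (nat \<Rightarrow> 'a) set" where
  "partial_strategies E I = (\<Pi>\<^sub>E i\<in>I. mspace (E i))"

abbreviation global_strategies :: "nat \<Rightarrow> (nat \<Rightarrow> 'a metric) \<Rightarrow> (nat \<Rightarrow> 'a) set" where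
  "global_strategies N E \<equiv> partial_strategies E {1..N}"

definition noncooperative_game ::
    "nat \<Rightarrow> (nat \<Rightarrow> 'a metric) \<Rightarrow> (nat \<Rightarrow> (nat \<Rightarrow> 'a) \<Rightarrow> real) \<Rightarrow> bool" where
  "noncooperative_game N E \<theta> \<longleftrightarrow>
     (\<forall>i\<in>{1..N}. continuous_map
        (product_topology (\<lambda>j. mtopology_of (E j)) {1..N}) euclideanreal (\<theta> i))"

definition k_subsets :: "nat \<Rightarrow> nat \<Rightarrow> nat set set" where
  "k_subsets N k = {I. I \<subseteq> {1..N} \<and> card I = k}"

text \<open>The strategy \<open>(y\<^sub>I, x\<^sub>-\<^sub>I)\<close> is \<open>override_on x y\<^sub>I I\<close>, and the projection \<open>y\<^sub>I\<close> of a global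
  strategy \<open>y\<close> is \<open>restrict y I\<close>.\<close>

definition lateral_Nash_equilibrium ::
    "nat \<Rightarrow> (nat \<Rightarrow> 'a metric) \<Rightarrow> (nat \<Rightarrow> (nat \<Rightarrow> 'a) \<Rightarrow> real) \<Rightarrow> nat \<Rightarrow> (nat \<Rightarrow> 'a) \<Rightarrow> bool" where
  "lateral_Nash_equilibrium N E \<theta> k x \<longleftrightarrow>
     x \<in> global_strategies N E \<and>
     (\<forall>I\<in>k_subsets N k. \<forall>i\<in>I. \<forall>yI\<in>partial_strategies E I.
        \<theta> i x \<ge> \<theta> i (override_on x yI I))"

text \<open>For \<open>1 \<le> k \<le> N\<close> both maxima range over finite nonempty sets.\<close>

definition Nikaido_Isoda ::
    "nat \<Rightarrow> (nat \<Rightarrow> (nat \<Rightarrow> 'a) \<Rightarrow> real) \<Rightarrow> nat \<Rightarrow> (nat \<Rightarrow> 'a) \<Rightarrow> (nat \<Rightarrow> 'a) \<Rightarrow> real" where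
  "Nikaido_Isoda N \<theta> k x y =
     (MAX I\<in>k_subsets N k. MAX i\<in>I.
        \<theta> i (override_on x (restrict y I) I) - \<theta> i (override_on x (restrict x I) I))"

definition marginal ::
    "nat \<Rightarrow> (nat \<Rightarrow> 'a metric) \<Rightarrow> (nat \<Rightarrow> (nat \<Rightarrow> 'a) \<Rightarrow> real) \<Rightarrow> nat \<Rightarrow> (nat \<Rightarrow> 'a) \<Rightarrow> ereal" where
  "marginal N E \<theta> k x = (SUP y\<in>global_strategies N E. ereal (Nikaido_Isoda N \<theta> k x y))"

end

theory Submission
  imports Defs
begin

text \<open>Taking \<open>y = x\<close> makes every difference in the Nikaido-Isoda function vanish,
  so its marginal is always at least 0 (\<open>marginal_nonneg\<close>); being 0 therefore means
  being at most 0, that is, the function is at most 0 at every \<open>y\<close>. A maximum is at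
  most 0 iff each of its entries is (\<open>Nikaido_Isoda_le_iff\<close>), which says that no
  coalition of size \<open>k\<close> has a deviation read off from a global \<open>y\<close> that
  benefits one of its members. Deviations of this kind are all deviations, since each partial
  strategy extends to a global one; this gives
  \<open>lateral_Nash_equilibrium_iff_Nikaido_Isoda_nonpos\<close>.\<close>

lemma finite_k_subsets: "finite (k_subsets N k)"
  unfolding k_subsets_def by (rule finite_subset[of _ "Pow {1..N}"]) auto

lemma k_subsets_nonempty: "k \<le> N \<Longrightarrow> k_subsets N k \<noteq> {}"
  using obtain_subset_with_card_n[of k "{1..N}"] by (auto simp: k_subsets_def)

lemma k_subsets_memberD:
  assumes "I \<in> k_subsets N k" and "1 \<le> k"
  shows "finite I" and "I \<noteq> {}"
  using assms by (auto simp: k_subsets_def intro: card_ge_0_finite)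

text \<open>\<open>Max\<close> is characterised by its upper bounds only on finite nonempty sets:
  \<open>k \<le> N\<close> provides a coalition, and \<open>1 \<le> k\<close> gives each coalition a
  member. The subtracted term collapses because overriding \<open>x\<close> by itself changes
  nothing.\<close>

lemma Nikaido_Isoda_le_iff:
  assumes "1 \<le> k" and "k \<le> N"
  shows "Nikaido_Isoda N \<theta> k x y \<le> c \<longleftrightarrow>
    (\<forall>I\<in>k_subsets N k. \<forall>i\<in>I. \<theta> i (override_on x y I) - \<theta> i x \<le> c)"
proof -
  have override: "override_on x (restrict z I) I = override_on x z I" for z and I :: "nat set"
    by (auto simp: override_on_def)
  have self: "override_on x x I = x" for I :: "nat set"
    by (auto simp: override_on_def)
  have inner: "(MAX i\<in>I. \<theta> i (override_on x y I) - \<theta> i x) \<le> c \<longleftrightarrow>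
      (\<forall>i\<in>I. \<theta> i (override_on x y I) - \<theta> i x \<le> c)" if "I \<in> k_subsets N k" for I
    using k_subsets_memberD[OF that assms(1)] by (subst Max_le_iff) auto
  show ?thesis
    unfolding Nikaido_Isoda_def override self
    using finite_k_subsets[of N k] k_subsets_nonempty[OF assms(2)] inner
    by (subst Max_le_iff) auto
qed

lemma Nikaido_Isoda_diagonal:
  assumes "1 \<le> k" and "k \<le> N"
  shows "Nikaido_Isoda N \<theta> k x x = 0"
proof -
  have self: "override_on x x I = x" for I :: "nat set"
    by (auto simp: override_on_def)
  obtain I i where "I \<in> k_subsets N k" and "i \<in> I"
    using k_subsets_nonempty[OF assms(2)] k_subsets_memberD(2)[OF _ assms(1)] by blast
  \<comment> \<open>All differences are 0, and the witnesses \<open>I\<close> and \<open>i\<close>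
    keep the bounded quantifiers from being vacuous. A real number with the same upper bounds as 0
    is 0.\<close>
  then have "Nikaido_Isoda N \<theta> k x x \<le> c \<longleftrightarrow> 0 \<le> c" for c
    by (auto simp: Nikaido_Isoda_le_iff[OF assms] self)
  then show ?thesis
    by (meson order.antisym order.refl)
qed

lemma marginal_nonneg:
  assumes "1 \<le> k" and "k \<le> N" and "x \<in> global_strategies N E"
  shows "0 \<le> marginal N E \<theta> k x"
  unfolding marginal_def
  using SUP_upper[OF assms(3), of "\<lambda>y. ereal (Nikaido_Isoda N \<theta> k x y)"]
  by (simp add: Nikaido_Isoda_diagonal[OF assms(1,2)] zero_ereal_def)

lemma override_on_global_strategies:
  assumes "x \<in> global_strategies N E" and "yI \<in> partial_strategies E I" and "I \<subseteq> {1..N}"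
  shows "override_on x yI I \<in> global_strategies N E"
  using assms by (fastforce simp: partial_strategies_def override_on_def PiE_iff extensional_def)

lemma restrict_partial_strategies:
  assumes "y \<in> global_strategies N E" and "I \<subseteq> {1..N}"
  shows "restrict y I \<in> partial_strategies E I"
  using assms by (auto simp: partial_strategies_def)

lemma lateral_Nash_equilibrium_iff_Nikaido_Isoda_nonpos:
  assumes "1 \<le> k" and "k \<le> N" and x: "x \<in> global_strategies N E"
  shows "lateral_Nash_equilibrium N E \<theta> k x \<longleftrightarrow>
    (\<forall>y\<in>global_strategies N E. Nikaido_Isoda N \<theta> k x y \<le> 0)"
proof
  assume eq: "lateral_Nash_equilibrium N E \<theta> k x"
  have "\<theta> i (override_on x y I) \<le> \<theta> i x"
    if "y \<in> global_strategies N E" "I \<in> k_subsets N k" "i \<in> I" for y I i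
  proof -
    have "restrict y I \<in> partial_strategies E I"
      using that restrict_partial_strategies by (auto simp: k_subsets_def)
    then have "\<theta> i (override_on x (restrict y I) I) \<le> \<theta> i x"
      using eq that by (auto simp: lateral_Nash_equilibrium_def)
    moreover have "override_on x (restrict y I) I = override_on x y I"
      by (auto simp: override_on_def)
    ultimately show ?thesis by simp
  qed
  then show "\<forall>y\<in>global_strategies N E. Nikaido_Isoda N \<theta> k x y \<le> 0"
    by (simp add: Nikaido_Isoda_le_iff[OF assms(1,2)])
next
  assume nonpos: "\<forall>y\<in>global_strategies N E. Nikaido_Isoda N \<theta> k x y \<le> 0"
  have "\<theta> i (override_on x yI I) \<le> \<theta> i x"
    if "I \<in> k_subsets N k" "i \<in> I" "yI \<in> partial_strategies E I" for I i yI
  proof -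
    \<comment> \<open>The Nikaido-Isoda function only tests global strategies, so \<open>yI\<close>
      is completed by the coordinates of \<open>x\<close> itself; overriding \<open>x\<close> by the
      result on \<open>I\<close> gives the same point again.\<close>
    let ?y = "override_on x yI I"
    have "?y \<in> global_strategies N E"
      using override_on_global_strategies[OF x that(3)] that(1) by (simp add: k_subsets_def)
    then have "\<theta> i (override_on x ?y I) \<le> \<theta> i x"
      using nonpos that by (simp add: Nikaido_Isoda_le_iff[OF assms(1,2)])
    moreover have "override_on x ?y I = ?y"
      by (auto simp: override_on_def)
    ultimately show ?thesis by simp
  qed
  with x show "lateral_Nash_equilibrium N E \<theta> k x"
    by (simp add: lateral_Nash_equilibrium_def)
qed

theorem theorem3p19:
  fixes N k :: nat
    and E :: "nat \<Rightarrow> 'a metric"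
    and \<theta> :: "nat \<Rightarrow> (nat \<Rightarrow> 'a) \<Rightarrow> real"
    and x :: "nat \<Rightarrow> 'a"
  assumes "1 \<le> N" and "1 \<le> k" and "k \<le> N"
    and "noncooperative_game N E \<theta>"
    and "x \<in> global_strategies N E"
  shows "lateral_Nash_equilibrium N E \<theta> k x \<longleftrightarrow> marginal N E \<theta> k x = 0"
proof -
  have "marginal N E \<theta> k x = 0 \<longleftrightarrow> marginal N E \<theta> k x \<le> 0"
    using marginal_nonneg[OF assms(2,3,5)] by (auto intro: order.antisym)
  \<comment> \<open>The supremum is taken in \<open>ereal\<close>, a complete lattice, so this holds
    without any prior boundedness of the values.\<close>
  also have "\<dots> \<longleftrightarrow> (\<forall>y\<in>global_strategies N E. Nikaido_Isoda N \<theta> k x y \<le> 0)"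
    by (simp add: marginal_def SUP_le_iff)
  finally show ?thesis
    using lateral_Nash_equilibrium_iff_Nikaido_Isoda_nonpos[OF assms(2,3,5)] by simp
qed

end
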